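(* Let $m\in\mathbb{N}$, $(\beta_0,\dots,\beta_m)\in D_m$ and $x\in\mathbb{R}$. Then $x\in[0,\frac{m}{\beta_m-1}]$ if and only if there exists a sequence $w=(w_i)_{i\ge1}\in\{0,\dots,m\}^{\mathbb{N}}$ such that $$x=\sum_{i=1}^\infty\frac{w_i}{\beta_{w_1}\beta_{w_2}\cdots\beta_{w_i}}.$$
   Context: $\mathbb{N}=\{1,2,3,\dots\}$. For $m\in\mathbb{N}$ and real numbers $\beta_0,\dots,\beta_m>1$ put $a_k:=\frac{k}{\beta_k}$ and $b_k:=\frac{k}{\beta_k}+\frac{m}{\beta_k(\beta_m-1)}$ for $k\in\{0,\dots,m\}$. Define $$D_m:=\{(\beta_0,\dots,\beta_m):\beta_0,\dots,\beta_m>1\text{ and }a_k<a_{k+1}\le b_k<b_{k+1}\text{ for all }0\le k\le m-1\}.$$ *)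

theory Defs
  imports "HOL-Analysis.Analysis"
begin

text \<open>A tuple \<open>(\<beta>\<^sub>0, \<dots>, \<beta>\<^sub>m)\<close> is represented by a function \<open>\<beta> :: nat \<Rightarrow> real\<close> of which only the
  values at \<open>0, \<dots>, m\<close> are ever used; values at larger arguments are unconstrained.\<close>

definition a_end :: "(nat \<Rightarrow> real) \<Rightarrow> nat \<Rightarrow> real" where
  "a_end \<beta> k = real k / \<beta> k"

definition b_end :: "nat \<Rightarrow> (nat \<Rightarrow> real) \<Rightarrow> nat \<Rightarrow> real" where
  "b_end m \<beta> k = real k / \<beta> k + real m / (\<beta> k * (\<beta> m - 1))"

definition D :: "nat \<Rightarrow> (nat \<Rightarrow> real) set" where
  "D m = {\<beta>. (\<forall>k\<in>{0..m}. \<beta> k > 1) \<and>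
     (\<forall>k<m. a_end \<beta> k < a_end \<beta> (k + 1) \<and> a_end \<beta> (k + 1) \<le> b_end m \<beta> k \<and> b_end m \<beta> k < b_end m \<beta> (k + 1))}"

text \<open>Sequences \<open>w\<close> are indexed from 1, while \<open>sums\<close> is indexed from 0;
  hence the shift, and \<open>w 0\<close> is never used.\<close>

definition is_expansion :: "(nat \<Rightarrow> real) \<Rightarrow> (nat \<Rightarrow> nat) \<Rightarrow> real \<Rightarrow> bool" where
  "is_expansion \<beta> w x \<longleftrightarrow> (\<lambda>n. real (w (Suc n)) / (\<Prod>j=1..Suc n. \<beta> (w j))) sums x"

end

theory Submission
  imports Defs
begin

text \<open>Put \<open>M = m / (\<beta>\<^sub>m - 1)\<close> and \<open>f\<^sub>k(y) = (k + y) / \<beta>\<^sub>k\<close>. Then \<open>f\<^sub>k\<close> maps \<open>[0, M]\<close> onto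
  \<open>[a\<^sub>k, b\<^sub>k]\<close>, and \<open>M\<close> is the fixed point of \<open>f\<^sub>m\<close>, so that \<open>b\<^sub>m = M\<close>. The conditions defining
  \<open>D\<^sub>m\<close> say that consecutive intervals \<open>[a\<^sub>k, b\<^sub>k]\<close> overlap or touch and that the \<open>b\<^sub>k\<close> increase;
  since \<open>a\<^sub>0 = 0\<close>, the intervals therefore cover exactly \<open>[0, M]\<close>. In other words, \<open>[0, M]\<close> is
  the attractor of the maps \<open>f\<^sub>0, \<dots>, f\<^sub>m\<close>.

  If \<open>x \<in> [0, M]\<close>, the covering (\<open>digit_exists\<close>) provides a digit \<open>k\<close> with
  \<open>\<beta>\<^sub>k x - k \<in> [0, M]\<close>, and this step can be repeated for ever. The orbit \<open>X\<close> so obtained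
  stays bounded while the products of the bases grow geometrically, so the remainder of the
  expansion tends to \<open>0\<close> (\<open>is_expansion_of_orbit\<close>). Conversely, \<open>f\<^sub>k(M) = b\<^sub>k \<le> M\<close> means that
  a partial sum, together with the remainder that it would have if the tail contributed \<open>M\<close>, never
  increases when the next digit is added; hence it stays at most \<open>M\<close>
  (\<open>partial_expansion_le\<close>).\<close>

lemma D_base_gt_1: "\<beta> \<in> D m \<Longrightarrow> k \<le> m \<Longrightarrow> \<beta> k > 1"
  by (simp add: D_def)

lemma b_end_eq: "b_end m \<beta> k = (real k + real m / (\<beta> m - 1)) / \<beta> k"
  by (simp add: b_end_def add_divide_distrib mult.commute)

lemma b_end_last:
  assumes "\<beta> m > 1"
  shows "b_end m \<beta> m = real m / (\<beta> m - 1)"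
  using assms by (simp add: b_end_eq field_simps)

lemma b_end_le:
  assumes "\<beta> \<in> D m" "k \<le> m"
  shows "b_end m \<beta> k \<le> real m / (\<beta> m - 1)"
proof -
  have "b_end m \<beta> k \<le> b_end m \<beta> m"
    using assms(2)
  proof (induction rule: inc_induct)
    case (step n)
    then have "b_end m \<beta> n < b_end m \<beta> (Suc n)"
      using assms(1) by (simp add: D_def)
    with step.IH show ?case by simp
  qed simp
  then show ?thesis
    using b_end_last[of \<beta> m] D_base_gt_1[OF assms(1), of m] by simp
qed

text \<open>The inequality \<open>a\<^sub>k\<^sub>+\<^sub>1 \<le> b\<^sub>k\<close> leaves no gap between consecutive intervals. Letting the right
  end be any \<open>b\<^sub>k\<close>, not only \<open>b\<^sub>m\<close>, makes the claim provable by induction on \<open>k\<close>.\<close>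

lemma intervals_cover:
  assumes "\<beta> \<in> D m" "k \<le> m" "0 \<le> x" "x \<le> b_end m \<beta> k"
  shows "\<exists>j\<le>k. a_end \<beta> j \<le> x \<and> x \<le> b_end m \<beta> j"
  using assms(2,4)
proof (induction k)
  case 0
  then show ?case using assms(3) by (simp add: a_end_def)
next
  case (Suc k)
  show ?case
  proof (cases "x \<le> b_end m \<beta> k")
    case True
    then show ?thesis using Suc by (meson Suc_leD le_SucI)
  next
    case False
    moreover have "a_end \<beta> (Suc k) \<le> b_end m \<beta> k"
      using assms(1) Suc.prems(1) by (simp add: D_def)
    ultimately show ?thesis using Suc.prems(2) by force
  qed
qed

lemma digit_exists:
  assumes "\<beta> \<in> D m" "y \<in> {0..real m / (\<beta> m - 1)}"
  shows "\<exists>k\<le>m. \<beta> k * y - real k \<in> {0..real m / (\<beta> m - 1)}"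
proof -
  have "y \<le> b_end m \<beta> m"
    using assms b_end_last[of \<beta> m] D_base_gt_1[OF assms(1), of m] by simp
  then obtain k where k: "k \<le> m" "a_end \<beta> k \<le> y" "y \<le> b_end m \<beta> k"
    using intervals_cover[OF assms(1) order_refl] assms(2) by auto
  have pos: "\<beta> k > 0" using D_base_gt_1[OF assms(1) k(1)] by simp
  have "real k \<le> \<beta> k * y"
    using k(2) pos by (simp add: a_end_def pos_divide_le_eq mult.commute)
  moreover have "\<beta> k * y \<le> real k + real m / (\<beta> m - 1)"
    using k(3) pos by (simp add: b_end_eq pos_le_divide_eq mult.commute)
  ultimately show ?thesis using k(1) by auto
qed

text \<open>Undoing one step of the orbit turns \<open>X n\<close> into the next term of the expansion plus the
  next remainder, so the sum telescopes.\<close>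

lemma partial_expansion_of_orbit:
  fixes \<beta> X :: "nat \<Rightarrow> real" and w :: "nat \<Rightarrow> nat"
  assumes "\<And>i. i \<ge> 1 \<Longrightarrow> \<beta> (w i) > 0"
    and "\<And>n. X (Suc n) = \<beta> (w (Suc n)) * X n - real (w (Suc n))"
  shows "(\<Sum>i<n. real (w (Suc i)) / (\<Prod>j=1..Suc i. \<beta> (w j))) = X 0 - X n / (\<Prod>j=1..n. \<beta> (w j))"
proof (induction n)
  case (Suc n)
  have "(\<Prod>j=1..n. \<beta> (w j)) > 0" "\<beta> (w (Suc n)) > 0"
    using assms(1) by (auto intro!: prod_pos)
  then have "X n / (\<Prod>j=1..n. \<beta> (w j))
      = real (w (Suc n)) / (\<Prod>j=1..Suc n. \<beta> (w j)) + X (Suc n) / (\<Prod>j=1..Suc n. \<beta> (w j))"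
    by (simp add: assms(2)[of n] mult.commute flip: add_divide_distrib)
  with Suc show ?case by simp
qed simp

lemma is_expansion_of_orbit:
  fixes \<beta> X :: "nat \<Rightarrow> real" and w :: "nat \<Rightarrow> nat"
  assumes "c > 1" and base: "\<And>i. i \<ge> 1 \<Longrightarrow> \<beta> (w i) \<ge> c"
    and step: "\<And>n. X (Suc n) = \<beta> (w (Suc n)) * X n - real (w (Suc n))"
    and bound: "\<And>n. \<bar>X n\<bar> \<le> M"
  shows "is_expansion \<beta> w (X 0)"
proof -
  let ?P = "\<lambda>n. \<Prod>j=1..n. \<beta> (w j)"
  have pos: "\<beta> (w i) > 0" if "i \<ge> 1" for i
    using base[OF that] \<open>c > 1\<close> by simp
  have P: "c ^ n \<le> ?P n" for n
  proof -
    have "(\<Prod>j=1..n. c) \<le> ?P n"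
      using base \<open>c > 1\<close> by (intro prod_mono) auto
    then show ?thesis by simp
  qed
  have "(\<lambda>n. M * (1 / c) ^ n) \<longlonglongrightarrow> M * 0"
    using \<open>c > 1\<close> by (intro tendsto_mult tendsto_const LIMSEQ_power_zero) simp
  then have lim0: "(\<lambda>n. M * (1 / c) ^ n) \<longlonglongrightarrow> 0" by simp
  have "norm (X n / ?P n) \<le> M * (1 / c) ^ n" for n
  proof -
    have "c ^ n > 0" using \<open>c > 1\<close> by simp
    then have "\<bar>X n\<bar> / ?P n \<le> M / c ^ n"
      using P[of n] bound[of n] by (intro frac_le) auto
    moreover have "?P n > 0" using P[of n] \<open>c ^ n > 0\<close> by linarith
    ultimately show ?thesis by (simp add: abs_divide power_one_over)
  qed
  then have "(\<lambda>n. X n / ?P n) \<longlonglongrightarrow> 0"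
    by (intro Lim_null_comparison[OF _ lim0] always_eventually) blast
  then have "(\<lambda>n. X 0 - X n / ?P n) \<longlonglongrightarrow> X 0 - 0"
    by (intro tendsto_diff tendsto_const)
  then show ?thesis
    unfolding is_expansion_def sums_def
    using partial_expansion_of_orbit[of \<beta> w X, OF pos step] by simp
qed

text \<open>The extra summand \<open>M / (\<beta>\<^bsub>w 1\<^esub> \<cdots> \<beta>\<^bsub>w n\<^esub>)\<close> is what turns the inequality into an induction
  invariant: adding a digit \<open>k\<close> replaces the tail \<open>M\<close> by \<open>(k + M) / \<beta>\<^sub>k\<close>, which is no larger.\<close>

lemma partial_expansion_le:
  fixes \<beta> :: "nat \<Rightarrow> real" and w :: "nat \<Rightarrow> nat" and M :: real
  assumes "\<And>i. i \<ge> 1 \<Longrightarrow> \<beta> (w i) > 0"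
    and "\<And>i. i \<ge> 1 \<Longrightarrow> (real (w i) + M) / \<beta> (w i) \<le> M"
  shows "(\<Sum>i<n. real (w (Suc i)) / (\<Prod>j=1..Suc i. \<beta> (w j))) + M / (\<Prod>j=1..n. \<beta> (w j)) \<le> M"
proof (induction n)
  case (Suc n)
  let ?P = "\<Prod>j=1..n. \<beta> (w j)"
  have "?P > 0" using assms(1) by (auto intro!: prod_pos)
  then have "(real (w (Suc n)) + M) / \<beta> (w (Suc n)) / ?P \<le> M / ?P"
    using assms(2)[of "Suc n"] by (intro divide_right_mono) auto
  then have "real (w (Suc n)) / (\<Prod>j=1..Suc n. \<beta> (w j)) + M / (\<Prod>j=1..Suc n. \<beta> (w j)) \<le> M / ?P"
    by (simp add: add_divide_distrib mult.commute)
  with Suc show ?case by simp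
qed simp

theorem proposition1p1:
  fixes m :: nat and \<beta> :: "nat \<Rightarrow> real" and x :: real
  assumes "m \<ge> 1" and "\<beta> \<in> D m"
  shows "x \<in> {0..real m / (\<beta> m - 1)} \<longleftrightarrow>
    (\<exists>w :: nat \<Rightarrow> nat. (\<forall>i\<ge>1. w i \<in> {0..m}) \<and> is_expansion \<beta> w x)"
proof
  let ?M = "real m / (\<beta> m - 1)"
  assume x: "x \<in> {0..?M}"
  obtain d where d: "\<And>y. y \<in> {0..?M} \<Longrightarrow> d y \<le> m \<and> \<beta> (d y) * y - real (d y) \<in> {0..?M}"
    using digit_exists[OF assms(2)] by metis
  define X where "X n = ((\<lambda>y. \<beta> (d y) * y - real (d y)) ^^ n) x" for n
  \<comment> \<open>The digit with index \<open>i\<close> is read off at time \<open>i - 1\<close>, because expansions start at index 1.\<close>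
  define w where "w i = d (X (i - 1))" for i
  have X: "X n \<in> {0..?M}" for n
    by (induction n) (use x d in \<open>simp_all add: X_def\<close>)
  have w: "w i \<le> m" for i
    using d X by (simp add: w_def)
  define c where "c = Min (\<beta> ` {0..m})"
  have "c > 1"
    using D_base_gt_1[OF assms(2)] by (simp add: c_def)
  moreover have "\<beta> (w i) \<ge> c" for i
    using w by (simp add: c_def)
  moreover have "X (Suc n) = \<beta> (w (Suc n)) * X n - real (w (Suc n))" for n
    by (simp add: X_def w_def)
  moreover have "\<bar>X n\<bar> \<le> ?M" for n
    using X[of n] by simp
  ultimately have "is_expansion \<beta> w (X 0)"
    by (rule is_expansion_of_orbit)
  then have "is_expansion \<beta> w x"
    by (simp add: X_def)
  with w show "\<exists>w. (\<forall>i\<ge>1. w i \<in> {0..m}) \<and> is_expansion \<beta> w x"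
    by auto
next
  let ?M = "real m / (\<beta> m - 1)"
  assume "\<exists>w. (\<forall>i\<ge>1. w i \<in> {0..m}) \<and> is_expansion \<beta> w x"
  then obtain w where w: "\<And>i. i \<ge> 1 \<Longrightarrow> w i \<le> m" and "is_expansion \<beta> w x"
    by auto
  then have lim: "(\<lambda>n. \<Sum>i<n. real (w (Suc i)) / (\<Prod>j=1..Suc i. \<beta> (w j))) \<longlonglongrightarrow> x"
    unfolding is_expansion_def sums_def by simp
  have pos: "\<beta> (w i) > 0" if "i \<ge> 1" for i
    using D_base_gt_1[OF assms(2) w[OF that]] by simp
  then have P: "(\<Prod>j=1..n. \<beta> (w j)) > 0" for n
    by (auto intro!: prod_pos)
  have "?M \<ge> 0"
    using D_base_gt_1[OF assms(2), of m] by simp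
  have "(real (w i) + ?M) / \<beta> (w i) \<le> ?M" if "i \<ge> 1" for i
    using b_end_le[OF assms(2) w[OF that]] by (simp add: b_end_eq)
  note le = partial_expansion_le[of \<beta> w, OF pos this]
  have "(\<Sum>i<n. real (w (Suc i)) / (\<Prod>j=1..Suc i. \<beta> (w j))) \<le> ?M" for n
    using le[of n] divide_nonneg_pos[OF \<open>?M \<ge> 0\<close> P[of n]] by linarith
  then have "x \<le> ?M"
    using LIMSEQ_le_const2[OF lim] by blast
  moreover have "x \<ge> 0"
    by (rule LIMSEQ_le_const[OF lim])
      (use P in \<open>auto intro!: sum_nonneg divide_nonneg_pos simp del: prod.cl_ivl_Suc\<close>)
  ultimately show "x \<in> {0..?M}" by simp
qed

end
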